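(* Let $G=(V,E)$ be a connected graph and let $\widehat G=(V,E\cup F)$ with $F\subseteq\binom{V}{2}\setminus E$. (a) For any cycle $C=(V_C,E_C)$ in $G$ and any $f\in E_C$, the inequality $x_f\le\sum_{e\in E_C\setminus\{f\}}x_e$ defines a facet of $\mathrm{LMC}(G,\widehat G)$ if and only if $C$ is chordless in $\widehat G$. (b) For any $f=uv\in F$ and any $uv$-path $P=(V_P,E_P)$ in $G$, the inequality $x_{uv}\le\sum_{e\in E_P}x_e$ defines a facet of $\mathrm{LMC}(G,\widehat G)$ if and only if $E_P\cup\{f\}$ induces a chordless cycle in $\widehat G$.
   Context: Graphs are finite, simple, undirected; $uv$ denotes $\{u,v\}$. A cycle is chordless in $\widehat G$ if no edge of $E\cup F$ joins two nodes of the cycle that are not consecutive on it. A decomposition of $G$ is a partition $\Pi$ of $V$ such that each block induces a connected subgraph of $G$; the multicut of $\widehat G$ lifted from $G$ induced by $\Pi$ is the set of edges of $E\cup F$ whose endpoints lie in distinct blocks of $\Pi$. $\mathrm{LMC}(G,\widehat G)\subseteq\mathbb{R}^{E\cup F}$ is the convex hull of the characteristic vectors of all multicuts of $\widehat G$ lifted from $G$. *)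

theory Defs
  imports "HOL-Analysis.Analysis" "HOL-Library.Disjoint_Sets" "HOL-Library.Ramsey"
begin

text \<open>
  A graph is given by a vertex set \<open>V\<close> and a set \<open>E\<close> of two-element vertex sets.
  Paths and cycles are subgraphs, i.e.\ pairs of a vertex set and an edge set, traced by a
  repetition-free list of vertices.
\<close>

definition simple_graph :: "'v set \<Rightarrow> 'v set set \<Rightarrow> bool" where
  "simple_graph V E \<longleftrightarrow> finite V \<and> E \<subseteq> nsets V 2"

definition subgraph :: "'v set \<Rightarrow> 'v set set \<Rightarrow> 'v set \<Rightarrow> 'v set set \<Rightarrow> bool" where
  "subgraph V' E' V E \<longleftrightarrow> V' \<subseteq> V \<and> E' \<subseteq> E"

definition walk_edges :: "'v list \<Rightarrow> 'v set set" where
  "walk_edges vs = {{vs ! i, vs ! Suc i} | i. Suc i < length vs}"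

definition is_path :: "'v \<Rightarrow> 'v \<Rightarrow> 'v set \<Rightarrow> 'v set set \<Rightarrow> bool" where
  "is_path u v VP EP \<longleftrightarrow>
    (\<exists>vs. vs \<noteq> [] \<and> distinct vs \<and> hd vs = u \<and> last vs = v \<and>
          VP = set vs \<and> EP = walk_edges vs)"

definition is_cycle :: "'v set \<Rightarrow> 'v set set \<Rightarrow> bool" where
  "is_cycle VC EC \<longleftrightarrow>
    (\<exists>vs. 3 \<le> length vs \<and> distinct vs \<and>
          VC = set vs \<and> EC = insert {last vs, hd vs} (walk_edges vs))"

text \<open>Two nodes of a cycle are consecutive on it iff they are joined by an edge of the cycle.\<close>

definition chordless :: "'v set \<Rightarrow> 'v set set \<Rightarrow> 'v set set \<Rightarrow> bool" where
  "chordless VC EC E \<longleftrightarrow>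
    \<not> (\<exists>u\<in>VC. \<exists>v\<in>VC. u \<noteq> v \<and> {u, v} \<notin> EC \<and> {u, v} \<in> E)"

definition connected_graph :: "'v set \<Rightarrow> 'v set set \<Rightarrow> bool" where
  "connected_graph V E \<longleftrightarrow>
    (\<forall>u\<in>V. \<forall>v\<in>V. \<exists>VP EP. is_path u v VP EP \<and> subgraph VP EP V E)"

definition induced_edges :: "'v set \<Rightarrow> 'v set set \<Rightarrow> 'v set set" where
  "induced_edges U E = {e \<in> E. e \<subseteq> U}"

definition decomposition :: "'v set \<Rightarrow> 'v set set \<Rightarrow> 'v set set \<Rightarrow> bool" where
  "decomposition V E \<D> \<longleftrightarrow>
    partition_on V \<D> \<and> (\<forall>U\<in>\<D>. connected_graph U (induced_edges U E))"

definition lifted_multicut :: "'v set set \<Rightarrow> 'v set set \<Rightarrow> 'v set set \<Rightarrow> 'v set set" where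
  "lifted_multicut E F \<D> =
    {{u, v} | u v. {u, v} \<in> E \<union> F \<and> (\<exists>A\<in>\<D>. \<exists>B\<in>\<D>. A \<noteq> B \<and> u \<in> A \<and> v \<in> B)}"

definition char_vec :: "'i set \<Rightarrow> real ^ 'i" where
  "char_vec M = (\<chi> e. if e \<in> M then 1 else 0)"

text \<open>
  The space of real vectors indexed by \<open>E \<union> F\<close> is represented as the coordinate subspace of
  \<open>real ^ ('v set)\<close> in which all coordinates outside \<open>E \<union> F\<close> vanish.  Convex hulls, faces
  and affine dimension, hence facets, do not depend on the ambient space.
\<close>

definition LMC :: "'v set \<Rightarrow> 'v set set \<Rightarrow> 'v set set \<Rightarrow> (real ^ ('v::finite set)) set" where
  "LMC V E F = convex hull {char_vec (lifted_multicut E F \<D>) | \<D>. decomposition V E \<D>}"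

text \<open>The inequality \<open>l x \<le> r x\<close> is valid for \<open>P\<close>, and the face where it is tight is a facet.\<close>

definition defines_facet ::
  "('a::euclidean_space \<Rightarrow> real) \<Rightarrow> ('a \<Rightarrow> real) \<Rightarrow> 'a set \<Rightarrow> bool" where
  "defines_facet l r P \<longleftrightarrow>
    (\<forall>x\<in>P. l x \<le> r x) \<and> {x \<in> P. l x = r x} facet_of P"

end

theory Submission
  imports Defs
begin

text \<open>
  In both parts the inequality belongs to a path \<open>P\<close> in \<open>G\<close> with at least three nodes whose ends
  are joined by an edge \<open>f\<close> of \<open>E \<union> F\<close>.

  A chord \<open>g\<close> splits the cycle \<open>P + f\<close> into two shorter cycles, and the inequality is the sum of the
  two valid inequalities in which \<open>g\<close> is bounded by the part of \<open>P\<close> it bypasses, and \<open>f\<close> by \<open>g\<close> and the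
  rest of \<open>P\<close>. Its face is thus strictly contained in another proper face.

  Without chords, the tight multicuts span the hyperplane where equality holds. A decomposition that
  keeps \<open>P\<close> together or cuts it once, and has at most one further non-singleton piece \<open>R\<close> which may be
  attached to one of the parts of \<open>P\<close>, is tight. Differences of their characteristic vectors yield
  first the vectors \<open>1_e + 1_f\<close> for \<open>e\<close> in \<open>P\<close>, then the unit vectors of edges between \<open>P\<close> and its
  complement, and then, by induction on the length of a connecting walk, those of the edges disjoint
  from \<open>P\<close>.
\<close>

section \<open>Edges of walks given as vertex lists\<close>

lemma walk_edges_Nil [simp]: "walk_edges [] = {}"
  and walk_edges_single [simp]: "walk_edges [x] = {}"
  by (auto simp: walk_edges_def)

lemma walk_edges_Cons_Cons [simp]:
  "walk_edges (x # y # zs) = insert {x, y} (walk_edges (y # zs))"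
proof -
  have "e \<in> insert {x, y} (walk_edges (y # zs))" if e: "e \<in> walk_edges (x # y # zs)" for e
  proof -
    obtain i where i: "Suc i < length (x # y # zs)"
      "e = {(x # y # zs) ! i, (x # y # zs) ! Suc i}"
      using e by (auto simp: walk_edges_def)
    then show ?thesis
      by (cases i) (auto simp: walk_edges_def)
  qed
  moreover have "e \<in> walk_edges (x # y # zs)" if e: "e \<in> walk_edges (y # zs)" for e
  proof -
    obtain i where "Suc i < length (y # zs)" "e = {(y # zs) ! i, (y # zs) ! Suc i}"
      using e by (auto simp: walk_edges_def)
    then show ?thesis
      unfolding walk_edges_def by (intro CollectI exI[of _ "Suc i"]) auto
  qed
  moreover have "{x, y} \<in> walk_edges (x # y # zs)"
    unfolding walk_edges_def by (intro CollectI exI[of _ 0]) auto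
  ultimately show ?thesis by blast
qed

lemma walk_edges_Cons: "xs \<noteq> [] \<Longrightarrow> walk_edges (x # xs) = insert {x, hd xs} (walk_edges xs)"
  by (cases xs) auto

lemma walk_edges_append:
  "xs \<noteq> [] \<Longrightarrow> ys \<noteq> [] \<Longrightarrow>
    walk_edges (xs @ ys) = insert {last xs, hd ys} (walk_edges xs \<union> walk_edges ys)"
  by (induction xs rule: induct_list012) (auto simp: walk_edges_Cons)

lemma walk_edges_subset: "e \<in> walk_edges ws \<Longrightarrow> e \<subseteq> set ws"
  by (auto simp: walk_edges_def)

lemma card_walk_edge: "distinct ws \<Longrightarrow> e \<in> walk_edges ws \<Longrightarrow> card e = 2"
  by (auto simp: walk_edges_def nth_eq_iff_index_eq)

lemma finite_walk_edges [simp]: "finite (walk_edges ws)"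
  by (induction ws rule: induct_list012) auto

lemma card_walk_edges: "distinct ws \<Longrightarrow> card (walk_edges ws) = length ws - 1"
proof (induction ws rule: induct_list012)
  case (3 x y zs)
  have "{x, y} \<notin> walk_edges (y # zs)"
    using 3(3) walk_edges_subset[of "{x, y}" "y # zs"] by auto
  then show ?case using 3 by simp
qed auto

text \<open>In a distinct list the head lies only in the first edge, and with at least three entries
  the other end of that edge is not the last entry.\<close>

lemma ends_notin_walk_edges:
  assumes "distinct ws" "3 \<le> length ws"
  shows "{hd ws, last ws} \<notin> walk_edges ws"
proof -
  obtain x y zs where ws: "ws = x # y # zs" "zs \<noteq> []"
    using assms(2) by (auto simp: Suc_le_length_iff numeral_3_eq_3)
  have "{x, last zs} \<notin> walk_edges (y # zs)"
    using assms(1) ws walk_edges_subset[of "{x, last zs}" "y # zs"] by auto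
  moreover have "last zs \<noteq> y"
    using assms(1) ws last_in_set by fastforce
  moreover have "last zs \<noteq> x"
    using assms(1) ws last_in_set by fastforce
  ultimately show ?thesis
    using ws by (auto simp: doubleton_eq_iff)
qed

lemma Union_walk_edges: "2 \<le> length ws \<Longrightarrow> \<Union>(walk_edges ws) = set ws"
proof (induction ws rule: induct_list012)
  case (3 x y zs)
  then show ?case by (cases zs) auto
qed auto

section \<open>Connectedness as reachability inside a vertex set\<close>

definition conn_in :: "'v set set \<Rightarrow> 'v set \<Rightarrow> bool" where
  "conn_in E U \<longleftrightarrow> (\<forall>u\<in>U. \<forall>v\<in>U. (u, v) \<in> {(x, y). x \<in> U \<and> y \<in> U \<and> {x, y} \<in> E}\<^sup>*)"

lemma conn_in_empty [simp]: "conn_in E {}"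
  and conn_in_single [simp]: "conn_in E {x}"
  by (auto simp: conn_in_def)

lemma conn_in_mono:
  assumes "conn_in E A" "A \<subseteq> U" "u \<in> A" "v \<in> A"
  shows "(u, v) \<in> {(x, y). x \<in> U \<and> y \<in> U \<and> {x, y} \<in> E}\<^sup>*"
proof -
  have "(u, v) \<in> {(x, y). x \<in> A \<and> y \<in> A \<and> {x, y} \<in> E}\<^sup>*"
    using assms by (auto simp: conn_in_def)
  moreover have "{(x, y). x \<in> A \<and> y \<in> A \<and> {x, y} \<in> E} \<subseteq> {(x, y). x \<in> U \<and> y \<in> U \<and> {x, y} \<in> E}"
    using assms by auto
  ultimately show ?thesis by (meson rtrancl_mono subsetD)
qed

lemma conn_in_Un_edge:
  assumes "conn_in E A" "conn_in E B" "a \<in> A" "b \<in> B" "{a, b} \<in> E"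
  shows "conn_in E (A \<union> B)"
proof -
  let ?R = "{(x, y). x \<in> A \<union> B \<and> y \<in> A \<union> B \<and> {x, y} \<in> E}"
  have A: "(u, v) \<in> ?R\<^sup>*" if "u \<in> A" "v \<in> A" for u v
    by (rule conn_in_mono[OF assms(1)]) (use that in auto)
  have B: "(u, v) \<in> ?R\<^sup>*" if "u \<in> B" "v \<in> B" for u v
    by (rule conn_in_mono[OF assms(2)]) (use that in auto)
  have ab: "(a, b) \<in> ?R" "(b, a) \<in> ?R"
    using assms by (auto simp: insert_commute)
  have "(u, v) \<in> ?R\<^sup>*" if "u \<in> A" "v \<in> B" for u v
    using A[OF that(1) assms(3)] ab(1) B[OF assms(4) that(2)]
    by (meson rtrancl.rtrancl_into_rtrancl rtrancl_trans)
  moreover have "(u, v) \<in> ?R\<^sup>*" if "u \<in> B" "v \<in> A" for u v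
    using B[OF that(1) assms(4)] ab(2) A[OF assms(3) that(2)]
    by (meson rtrancl.rtrancl_into_rtrancl rtrancl_trans)
  ultimately show ?thesis
    unfolding conn_in_def using A B by blast
qed

lemma conn_in_Un:
  assumes "conn_in E A" "conn_in E B" "A \<inter> B \<noteq> {}"
  shows "conn_in E (A \<union> B)"
proof -
  let ?R = "{(x, y). x \<in> A \<union> B \<and> y \<in> A \<union> B \<and> {x, y} \<in> E}"
  obtain c where c: "c \<in> A" "c \<in> B" using assms(3) by blast
  have A: "(u, v) \<in> ?R\<^sup>*" if "u \<in> A" "v \<in> A" for u v
    by (rule conn_in_mono[OF assms(1)]) (use that in auto)
  have B: "(u, v) \<in> ?R\<^sup>*" if "u \<in> B" "v \<in> B" for u v
    by (rule conn_in_mono[OF assms(2)]) (use that in auto)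
  have "(u, c) \<in> ?R\<^sup>*" "(c, u) \<in> ?R\<^sup>*" if "u \<in> A \<union> B" for u
    using A B c that by auto
  then show ?thesis
    unfolding conn_in_def by (meson rtrancl_trans)
qed

lemma conn_in_walk: "walk_edges ws \<subseteq> E \<Longrightarrow> conn_in E (set ws)"
proof (induction ws rule: induct_list012)
  case (3 x y zs)
  then have "conn_in E ({x} \<union> set (y # zs))"
    by (intro conn_in_Un_edge[of E "{x}" "set (y # zs)" x y]) auto
  then show ?case by (simp add: insert_commute)
qed auto

text \<open>Links reachability, which glues easily along unions, to connectedness by repetition-free
  paths. The induction carries such a path along; if the next vertex already lies on it, the path is
  truncated there.\<close>

lemma conn_in_connected_graph:
  assumes "conn_in E U"
  shows "connected_graph U (induced_edges U E)"
  unfolding connected_graph_def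
proof (intro ballI)
  fix u v assume u: "u \<in> U" and v: "v \<in> U"
  let ?R = "{(x, y). x \<in> U \<and> y \<in> U \<and> {x, y} \<in> E}"
  have "(u, v) \<in> ?R\<^sup>*" using assms u v by (auto simp: conn_in_def)
  then have "\<exists>ws. ws \<noteq> [] \<and> distinct ws \<and> hd ws = u \<and> last ws = v \<and> set ws \<subseteq> U \<and>
    walk_edges ws \<subseteq> induced_edges U E"
  proof (induction rule: rtrancl_induct)
    case base
    show ?case by (rule exI[of _ "[u]"]) (use u in auto)
  next
    case (step y z)
    then obtain ws where ws: "ws \<noteq> []" "distinct ws" "hd ws = u" "last ws = y" "set ws \<subseteq> U"
      "walk_edges ws \<subseteq> induced_edges U E" by blast
    show ?case
    proof (cases "z \<in> set ws")
      case True
      then obtain xs ys where "ws = xs @ z # ys" by (meson split_list)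
      then have eq: "ws = (xs @ [z]) @ ys" by simp
      have "walk_edges (xs @ [z]) \<subseteq> walk_edges ws"
        unfolding eq using walk_edges_append[of "xs @ [z]" ys] by (cases "ys = []") auto
      moreover have "hd (xs @ [z]) = u"
        using ws(3) eq by (cases xs) auto
      moreover have "set (xs @ [z]) \<subseteq> U" "distinct (xs @ [z])"
        using ws(2,5) eq by auto
      ultimately show ?thesis
        using ws(6) by (intro exI[of _ "xs @ [z]"] conjI) (blast | simp)+
    next
      case False
      have "{y, z} \<in> induced_edges U E" using step(2) by (auto simp: induced_edges_def)
      moreover have "z \<in> U" using step(2) by auto
      ultimately show ?thesis
        using ws False by (intro exI[of _ "ws @ [z]"]) (auto simp: walk_edges_append)
    qed
  qed
  then show "\<exists>VP EP. is_path u v VP EP \<and> subgraph VP EP U (induced_edges U E)"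
    unfolding is_path_def subgraph_def by blast
qed

lemma connected_graph_walk:
  assumes "connected_graph V E" "u \<in> V" "v \<in> V"
  obtains ws where "ws \<noteq> []" "distinct ws" "hd ws = u" "last ws = v" "set ws \<subseteq> V"
    "walk_edges ws \<subseteq> E"
proof -
  obtain VP EP where "is_path u v VP EP" "subgraph VP EP V E"
    using assms unfolding connected_graph_def by blast
  then show ?thesis
    using that by (auto simp: is_path_def subgraph_def)
qed

section \<open>Characteristic vectors\<close>

lemma char_vec_nth [simp]: "char_vec M $ e = (if e \<in> M then 1 else 0)"
  by (simp add: char_vec_def)

lemma sum_char_vec: "finite A \<Longrightarrow> (\<Sum>e\<in>A. char_vec M $ e) = real (card (A \<inter> M))"
  by (simp add: sum.If_cases)

lemma inner_char_vec: "char_vec M \<bullet> x = (\<Sum>e\<in>M. x $ e)"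
  by (simp add: inner_vec_def sum.If_cases if_distrib[where f = "\<lambda>c. c * _"] cong: if_cong)

lemma char_vec_Un: "A \<inter> B = {} \<Longrightarrow> char_vec (A \<union> B) = char_vec A + char_vec B"
  by (auto simp: vec_eq_iff)

lemma char_vec_Diff: "B \<subseteq> A \<Longrightarrow> char_vec (A - B) = char_vec A - char_vec B"
  by (auto simp: vec_eq_iff)

lemma char_vec_empty [simp]: "char_vec {} = 0"
  by (auto simp: vec_eq_iff)

lemma char_vec_sum: "char_vec M = (\<Sum>e\<in>M. char_vec {e})"
  by (auto simp: vec_eq_iff if_distrib sum.If_cases)

lemma char_vec_singleton: "char_vec {e} = axis e 1"
  by (auto simp: vec_eq_iff axis_def)

lemma independent_char_vec:
  fixes K :: "'i::finite set"
  shows "independent ((\<lambda>e. char_vec {e}) ` K)" "card ((\<lambda>e. char_vec {e}) ` K) = card K"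
proof -
  have "(\<lambda>e. char_vec {e}) ` K \<subseteq> (Basis :: (real^'i) set)"
    by (auto simp: char_vec_singleton axis_in_Basis_iff)
  then show "independent ((\<lambda>e. char_vec {e}) ` K)"
    using independent_Basis independent_mono by blast
  have "inj_on (\<lambda>e. char_vec {e}) K"
    by (auto simp: inj_on_def char_vec_singleton axis_eq_axis)
  then show "card ((\<lambda>e. char_vec {e}) ` K) = card K"
    by (rule card_image)
qed

section \<open>Faces given by tight inequalities, and maximality of facets\<close>

lemma face_of_tight:
  fixes P :: "(real ^ 'i::finite) set"
  assumes "convex P" "\<And>x. x \<in> P \<Longrightarrow> x $ f \<le> (\<Sum>e\<in>A. x $ e)"
  shows "{x \<in> P. x $ f = (\<Sum>e\<in>A. x $ e)} face_of P"
proof -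
  \<comment> \<open>The vector \<open>char_vec {f} - char_vec A\<close> is the normal of a
    supporting hyperplane through the origin.\<close>
  have *: "(char_vec {f} - char_vec A) \<bullet> x = x $ f - (\<Sum>e\<in>A. x $ e)" for x :: "real ^ 'i"
    by (simp add: inner_diff_left inner_char_vec)
  have "P \<inter> {x. (char_vec {f} - char_vec A) \<bullet> x = 0} face_of P"
    by (rule face_of_Int_supporting_hyperplane_le) (use assms in \<open>auto simp: *\<close>)
  moreover have "P \<inter> {x. (char_vec {f} - char_vec A) \<bullet> x = 0} = {x \<in> P. x $ f = (\<Sum>e\<in>A. x $ e)}"
    by (auto simp: *)
  ultimately show ?thesis by simp
qed

text \<open>The affine dimension drops strictly from a convex set to a proper face. A face strictly
  between \<open>A\<close> and \<open>P\<close> would force two drops, but a facet leaves room for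
  only one.\<close>

lemma facet_of_maximal:
  fixes P :: "'a::euclidean_space set"
  assumes "A facet_of P" "B face_of P" "A \<subseteq> B" "B \<noteq> P" "convex P"
  shows "A = B"
proof (rule ccontr)
  assume "A \<noteq> B"
  have "A face_of B"
    using assms face_of_subset face_of_imp_subset facet_of_imp_face_of by metis
  then have "aff_dim A < aff_dim B"
    using \<open>A \<noteq> B\<close> assms face_of_aff_dim_lt face_of_imp_convex by metis
  moreover have "aff_dim B < aff_dim P"
    using assms face_of_aff_dim_lt by metis
  ultimately show False
    using assms(1) by (auto simp: facet_of_def)
qed

lemma split_list_pair:
  assumes "a \<in> set ws" "b \<in> set ws" "a \<noteq> b"
  obtains xs u ys v zs where "ws = xs @ [u] @ ys @ [v] @ zs" "{u, v} = {a, b}"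
proof -
  obtain xs ys where ws: "ws = xs @ a # ys" using assms(1) by (meson split_list)
  show thesis
  proof (cases "b \<in> set ys")
    case True
    then obtain ys' zs where "ys = ys' @ b # zs" by (meson split_list)
    then show thesis using that[of xs a ys' b zs] ws by simp
  next
    case False
    then have "b \<in> set xs" using assms ws by auto
    then obtain xs' zs where "xs = xs' @ b # zs" by (meson split_list)
    then show thesis using that[of xs' b zs a ys] ws by (simp add: insert_commute)
  qed
qed

section \<open>Lifted multicuts of partitions and of decompositions with few large blocks\<close>

lemma lifted_multicut_iff:
  assumes "partition_on V \<D>" "u \<in> V" "v \<in> V"
  shows "{u, v} \<in> lifted_multicut E F \<D> \<longleftrightarrow>
    {u, v} \<in> E \<union> F \<and> (\<forall>A\<in>\<D>. \<not> (u \<in> A \<and> v \<in> A))"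
proof -
  have un: "A = B" if "A \<in> \<D>" "B \<in> \<D>" "x \<in> A" "x \<in> B" for A B x
    using assms(1) that by (auto simp: partition_on_def disjoint_def)
  have ex: "\<exists>A\<in>\<D>. x \<in> A" if "x \<in> V" for x
    using assms(1) that by (auto simp: partition_on_def)
  show ?thesis
  proof
    assume "{u, v} \<in> lifted_multicut E F \<D>"
    then obtain a b A B where *: "{u, v} = {a, b}" "{a, b} \<in> E \<union> F" "A \<in> \<D>" "B \<in> \<D>" "A \<noteq> B"
      "a \<in> A" "b \<in> B"
      unfolding lifted_multicut_def by blast
    have "\<not> (a \<in> C \<and> b \<in> C)" if "C \<in> \<D>" for C
      using un[OF *(3) that] un[OF *(4) that] *(5-7) by blast
    moreover have "u = a \<and> v = b \<or> u = b \<and> v = a"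
      using *(1) by (auto simp: doubleton_eq_iff)
    ultimately show "{u, v} \<in> E \<union> F \<and> (\<forall>A\<in>\<D>. \<not> (u \<in> A \<and> v \<in> A))"
      using *(1,2) by auto
  next
    assume *: "{u, v} \<in> E \<union> F \<and> (\<forall>A\<in>\<D>. \<not> (u \<in> A \<and> v \<in> A))"
    obtain A where A: "A \<in> \<D>" "u \<in> A" using ex assms(2) by blast
    obtain B where B: "B \<in> \<D>" "v \<in> B" using ex assms(3) by blast
    have "A \<noteq> B" using * A B by auto
    then have "\<exists>A\<in>\<D>. \<exists>B\<in>\<D>. A \<noteq> B \<and> u \<in> A \<and> v \<in> B"
      using A B by metis
    then show "{u, v} \<in> lifted_multicut E F \<D>"
      unfolding lifted_multicut_def mem_Collect_eq using * by metis
  qed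
qed

text \<open>An uncut edge has both ends in one block, and blocks sharing a node coincide, so the
  block of the last node is passed back along the walk to the first.\<close>

lemma lifted_multicut_walk:
  assumes "partition_on V \<D>"
  shows "ws \<noteq> [] \<Longrightarrow> set ws \<subseteq> V \<Longrightarrow> walk_edges ws \<subseteq> E \<union> F \<Longrightarrow>
    walk_edges ws \<inter> lifted_multicut E F \<D> = {} \<Longrightarrow> \<exists>A\<in>\<D>. hd ws \<in> A \<and> last ws \<in> A"
proof (induction ws rule: induct_list012)
  case (2 x)
  then show ?case using assms by (auto simp: partition_on_def)
next
  case (3 x y zs)
  then obtain A where A: "A \<in> \<D>" "y \<in> A" "last (y # zs) \<in> A" by auto
  have "{x, y} \<in> E \<union> F" "{x, y} \<notin> lifted_multicut E F \<D>"
    using 3 by auto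
  then obtain B where B: "B \<in> \<D>" "x \<in> B" "y \<in> B"
    using lifted_multicut_iff[OF assms, of x y E F] 3(4) by auto
  have "A = B"
    using assms A B by (auto simp: partition_on_def disjoint_def)
  then show ?case using A B by (intro bexI[of _ A]) simp_all
qed simp

text \<open>Empty members of \<open>Us\<close> are dropped, so \<open>Us\<close> may be given as \<open>{A, B}\<close> even if \<open>A = {}\<close>.\<close>

definition singleton_completion :: "'v set \<Rightarrow> 'v set set \<Rightarrow> 'v set set" where
  "singleton_completion V Us = (Us - {{}}) \<union> (\<lambda>x. {x}) ` (V - \<Union>Us)"

lemma decomposition_singleton_completion:
  assumes "disjoint Us" "\<And>U. U \<in> Us \<Longrightarrow> U \<subseteq> V \<and> conn_in E U"
  shows "decomposition V E (singleton_completion V Us)"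
proof -
  have "partition_on V (singleton_completion V Us)"
    using assms unfolding singleton_completion_def
    by (intro partition_onI) (fastforce simp: disjoint_def disjnt_def)+
  moreover have "connected_graph U (induced_edges U E)" if "U \<in> singleton_completion V Us" for U
    using that assms(2) unfolding singleton_completion_def
    by (intro conn_in_connected_graph) auto
  ultimately show ?thesis by (simp add: decomposition_def)
qed

text \<open>No edge fits into a singleton, so an edge escapes the cut only by lying inside a member
  of \<open>Us\<close>.\<close>

lemma lifted_multicut_singleton_completion:
  assumes "disjoint Us" "\<And>U. U \<in> Us \<Longrightarrow> U \<subseteq> V \<and> conn_in E U" "E \<union> F \<subseteq> nsets V 2"
  shows "lifted_multicut E F (singleton_completion V Us) = {e \<in> E \<union> F. \<forall>U\<in>Us. \<not> e \<subseteq> U}"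
proof (rule set_eqI)
  fix e
  let ?D = "singleton_completion V Us"
  have p: "partition_on V ?D"
    using decomposition_singleton_completion[OF assms(1,2)] by (simp add: decomposition_def)
  show "e \<in> lifted_multicut E F ?D \<longleftrightarrow> e \<in> {e \<in> E \<union> F. \<forall>U\<in>Us. \<not> e \<subseteq> U}"
  proof (cases "e \<in> E \<union> F")
    case True
    then obtain u v where uv: "e = {u, v}" "u \<noteq> v" "u \<in> V" "v \<in> V"
      using assms(3) by (auto simp: nsets_def card_2_iff)
    show ?thesis
      using True uv lifted_multicut_iff[OF p uv(3,4), of E F]
      by (auto simp: singleton_completion_def)
  next
    case False
    then show ?thesis by (auto simp: lifted_multicut_def)
  qed
qed

section \<open>The polytope: walk inequalities and an upper bound on its dimension\<close>

locale lifted_graph =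
  fixes V :: "'v::finite set" and E F :: "'v set set"
  assumes edges: "E \<union> F \<subseteq> nsets V 2" and connected: "connected_graph V E"
begin

abbreviation K :: "'v set set" where "K \<equiv> E \<union> F"

lemma K_pair:
  assumes "e \<in> K"
  obtains a b where "e = {a, b}" "a \<noteq> b" "a \<in> V" "b \<in> V"
  using assms edges by (auto simp: nsets_def card_2_iff)

lemma convex_LMC: "convex (LMC V E F)"
  by (simp add: LMC_def)

lemma char_vec_in_LMC:
  assumes "disjoint Us" "\<And>U. U \<in> Us \<Longrightarrow> U \<subseteq> V \<and> conn_in E U"
  shows "char_vec {e \<in> K. \<forall>U\<in>Us. \<not> e \<subseteq> U} \<in> LMC V E F"
proof -
  have "char_vec (lifted_multicut E F (singleton_completion V Us)) \<in> LMC V E F"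
    unfolding LMC_def using decomposition_singleton_completion[OF assms]
    by (intro hull_inc) blast
  then show ?thesis
    by (simp add: lifted_multicut_singleton_completion[OF assms edges])
qed

lemma LMC_walk_inequality:
  assumes "ws \<noteq> []" "set ws \<subseteq> V" "walk_edges ws \<subseteq> K" "x \<in> LMC V E F"
  shows "x $ {hd ws, last ws} \<le> (\<Sum>e\<in>walk_edges ws. x $ e)"
proof -
  let ?f = "{hd ws, last ws}" and ?A = "walk_edges ws"
  let ?a = "char_vec {?f} - char_vec ?A :: real ^ 'v set"
  have *: "?a \<bullet> x = x $ ?f - (\<Sum>e\<in>?A. x $ e)" for x
    by (simp add: inner_diff_left inner_char_vec)
  have "LMC V E F \<subseteq> {x. ?a \<bullet> x \<le> 0}"
    unfolding LMC_def
  proof (rule hull_minimal)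
    show "convex {x. ?a \<bullet> x \<le> 0}" by (rule convex_halfspace_le)
    have "char_vec (lifted_multicut E F \<D>) $ ?f \<le>
      (\<Sum>e\<in>?A. char_vec (lifted_multicut E F \<D>) $ e)" if "decomposition V E \<D>" for \<D>
    proof (cases "?A \<inter> lifted_multicut E F \<D> = {}")
      case True
      have p: "partition_on V \<D>" using that by (simp add: decomposition_def)
      obtain B where "B \<in> \<D>" "hd ws \<in> B" "last ws \<in> B"
        using lifted_multicut_walk[OF p assms(1-3) True] by blast
      then have "?f \<notin> lifted_multicut E F \<D>"
        using lifted_multicut_iff[OF p, of "hd ws" "last ws" E F] assms(1,2) hd_in_set last_in_set by blast
      then show ?thesis by (simp add: sum_nonneg)
    next
      case False
      then have "card (?A \<inter> lifted_multicut E F \<D>) \<ge> 1"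
        by (simp add: Suc_le_eq card_gt_0_iff)
      then show ?thesis
        by (subst sum_char_vec) auto
    qed
    then show "{char_vec (lifted_multicut E F \<D>) |\<D>. decomposition V E \<D>} \<subseteq> {x. ?a \<bullet> x \<le> 0}"
      by (auto simp only: * mem_Collect_eq diff_le_0_iff_le)
  qed
  then show ?thesis using assms(4) * by auto
qed

text \<open>Connectedness of the graph makes all of \<open>V\<close> a single block, which cuts
  nothing. The origin is tight for every path inequality, so dimensions of tight faces can be
  computed linearly.\<close>

lemma zero_in_LMC: "0 \<in> LMC V E F"
proof -
  have "conn_in E V"
    unfolding conn_in_def
  proof (intro ballI)
    fix u v assume "u \<in> V" "v \<in> V"
    then obtain ws where ws: "ws \<noteq> []" "distinct ws" "hd ws = u" "last ws = v" "set ws \<subseteq> V"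
      "walk_edges ws \<subseteq> E"
      using connected_graph_walk[OF connected] by metis
    then show "(u, v) \<in> {(x, y). x \<in> V \<and> y \<in> V \<and> {x, y} \<in> E}\<^sup>*"
      by (intro conn_in_mono[OF conn_in_walk[OF ws(6)] ws(5)]) auto
  qed
  then have "char_vec {e \<in> K. \<forall>U\<in>{V}. \<not> e \<subseteq> U} \<in> LMC V E F"
    by (intro char_vec_in_LMC) (auto simp: disjoint_def)
  moreover have "{e \<in> K. \<forall>U\<in>{V}. \<not> e \<subseteq> U} = {}"
    using edges by (auto simp: nsets_def)
  ultimately show ?thesis by (metis char_vec_empty)
qed

text \<open>All generators vanish outside \<open>K\<close>, so the polytope lies in a coordinate
  subspace of dimension \<open>card K\<close>. The matching lower bound is implicit in
  \<open>tight_facet\<close>.\<close>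

lemma aff_dim_LMC_le: "aff_dim (LMC V E F) \<le> int (card K)"
proof -
  let ?B = "(\<lambda>e. char_vec {e}) ` K :: (real ^ 'v set) set"
  have "char_vec (lifted_multicut E F \<D>) \<in> span ?B" for \<D>
  proof -
    have "lifted_multicut E F \<D> \<subseteq> K" by (auto simp: lifted_multicut_def)
    then show ?thesis
      by (subst char_vec_sum, intro span_sum span_base) auto
  qed
  then have "LMC V E F \<subseteq> span ?B"
    unfolding LMC_def by (intro hull_minimal) (auto simp: subspace_imp_convex)
  then have "aff_dim (LMC V E F) \<le> aff_dim (span ?B)"
    by (rule aff_dim_subset)
  also have "\<dots> = int (dim ?B)"
    by (simp add: aff_dim_subspace)
  also have "dim ?B = card K"
    using dim_eq_card_independent[OF independent_char_vec(1), of K] independent_char_vec(2)[of K] by simp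
  finally show ?thesis by simp
qed

end

section \<open>The path inequality, and why a chord prevents a facet\<close>

locale lifted_path = lifted_graph V E F
  for V :: "'v::finite set" and E F :: "'v set set" +
  fixes vs :: "'v list"
  assumes distinct: "distinct vs" and length: "3 \<le> length vs" and set_vs: "set vs \<subseteq> V"
    and path: "walk_edges vs \<subseteq> E" and ends: "{hd vs, last vs} \<in> E \<union> F"
begin

abbreviation "f \<equiv> {hd vs, last vs}"
abbreviation "P \<equiv> walk_edges vs"
abbreviation "Q \<equiv> insert f P"
abbreviation "tight \<equiv> {x \<in> LMC V E F. x $ f = (\<Sum>e\<in>P. x $ e)}"

lemma vs_nonempty [simp]: "vs \<noteq> []"
  using length by auto

lemma f_notin_P: "f \<notin> P"
  by (rule ends_notin_walk_edges[OF distinct length])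

lemma valid: "x \<in> LMC V E F \<Longrightarrow> x $ f \<le> (\<Sum>e\<in>P. x $ e)"
  using path set_vs by (intro LMC_walk_inequality) auto

lemma tight_face: "tight face_of LMC V E F"
  by (rule face_of_tight[OF convex_LMC valid])

text \<open>The decomposition into singletons cuts every edge.\<close>

lemma char_vec_K_in_LMC: "char_vec K \<in> LMC V E F"
proof -
  have "{e \<in> K. \<forall>U\<in>{}. \<not> e \<subseteq> U} = K" by blast
  moreover have "char_vec {e \<in> K. \<forall>U\<in>{}. \<not> e \<subseteq> U} \<in> LMC V E F"
    by (rule char_vec_in_LMC) (auto simp: disjoint_def)
  ultimately show ?thesis by simp
qed

text \<open>Cutting every edge makes the left side 1 and the right side at least 2.\<close>

lemma tight_proper: "tight \<noteq> LMC V E F"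
proof -
  have "P \<inter> K = P" using path by auto
  then have "(\<Sum>e\<in>P. char_vec K $ e) = real (length vs - 1)"
    by (subst sum_char_vec) (auto simp: card_walk_edges[OF distinct])
  moreover have "char_vec K $ f = 1" using ends by simp
  ultimately have "char_vec K \<notin> tight" using length by auto
  then show ?thesis using char_vec_K_in_LMC by blast
qed

text \<open>A chord is no path edge, hence \<open>ys\<close> is nonempty; it is not
  \<open>f\<close>, hence something remains before \<open>u\<close> or after
  \<open>v\<close>.\<close>

lemma chord_decomposition:
  assumes "\<not> chordless (set vs) Q K"
  obtains xs u ys v zs where "vs = xs @ [u] @ ys @ [v] @ zs" "{u, v} \<in> K" "ys \<noteq> []"
    "xs \<noteq> [] \<or> zs \<noteq> []" "{u, v} \<notin> Q"
proof -
  obtain a b where ab: "a \<in> set vs" "b \<in> set vs" "a \<noteq> b" "{a, b} \<notin> Q" "{a, b} \<in> K"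
    using assms by (auto simp: chordless_def)
  obtain xs u ys v zs where vs: "vs = xs @ [u] @ ys @ [v] @ zs" and uv: "{u, v} = {a, b}"
    using split_list_pair[OF ab(1-3)] .
  have "ys \<noteq> []"
  proof
    assume "ys = []"
    then have "{u, v} \<in> P"
      unfolding vs using walk_edges_append[of "xs @ [u]" "v # zs"] by simp
    then show False using ab(4) uv by simp
  qed
  moreover have "xs \<noteq> [] \<or> zs \<noteq> []"
  proof (rule ccontr)
    assume "\<not> ?thesis"
    then have "f = {u, v}" using vs by simp
    then show False using ab(4) uv by simp
  qed
  ultimately show thesis using that[of xs u ys v zs] vs uv ab(4,5) by simp
qed

lemma facet_imp_chordless:
  assumes "tight facet_of LMC V E F"
  shows "chordless (set vs) Q K"
proof (rule ccontr)
  assume "\<not> ?thesis"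
  then obtain xs u ys v zs where vs: "vs = xs @ [u] @ ys @ [v] @ zs" and uv: "{u, v} \<in> K"
    and ys: "ys \<noteq> []" and xz: "xs \<noteq> [] \<or> zs \<noteq> []" and uvQ: "{u, v} \<notin> Q"
    by (rule chord_decomposition)
  \<comment> \<open>\<open>?I\<close> is the part of the path bypassed by the chord;
    \<open>?L\<close> and \<open>?R\<close> are the remaining parts on either side.\<close>
  let ?I = "walk_edges (u # ys @ [v])"
  let ?L = "walk_edges (xs @ [u])" and ?R = "walk_edges (v # zs)"
  have P: "P = ?L \<union> ?I \<union> ?R"
  proof -
    have 1: "P = walk_edges (xs @ [u]) \<union> walk_edges (u # ys @ [v] @ zs)"
    proof (cases "xs = []")
      case False
      then show ?thesis unfolding vs
        using walk_edges_append[of xs "[u]"] walk_edges_append[of xs "u # ys @ [v] @ zs"] by auto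
    qed (simp add: vs)
    have 2: "walk_edges (u # ys @ [v] @ zs) = ?I \<union> ?R"
    proof (cases "zs = []")
      case False
      then show ?thesis
        using walk_edges_append[of "u # ys @ [v]" zs] walk_edges_append[of "[v]" zs] by auto
    qed simp
    show ?thesis using 1 2 by auto
  qed
  have dist: "distinct (xs @ [u] @ ys @ [v] @ zs)" using distinct vs by simp
  have two: "card e = 2" if "e \<in> ?L \<union> ?I \<union> ?R" for e
    using card_walk_edge[OF distinct] P that by simp
  have small: "\<not> e \<subseteq> {w}" if "e \<in> ?L \<union> ?I \<union> ?R" for e w
  proof
    assume "e \<subseteq> {w}"
    then have "card e \<le> 1" by (metis card.empty card_insert_disjoint finite.emptyI card_mono
      empty_iff finite_insert One_nat_def)
    then show False using two[OF that] by simp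
  qed
  have LI: "?L \<inter> ?I = {}"
  proof (intro equals0I)
    fix e assume e: "e \<in> ?L \<inter> ?I"
    then have "e \<subseteq> set (xs @ [u]) \<inter> set (u # ys @ [v])"
      using walk_edges_subset by blast
    then have "e \<subseteq> {u}" using dist by auto
    then show False using small e by blast
  qed
  have RI: "?R \<inter> ?I = {}"
  proof (intro equals0I)
    fix e assume e: "e \<in> ?R \<inter> ?I"
    then have "e \<subseteq> set (v # zs) \<inter> set (u # ys @ [v])"
      using walk_edges_subset by blast
    then have "e \<subseteq> {v}" using dist by auto
    then show False using small e by blast
  qed
  have LR: "?L \<inter> ?R = {}"
  proof (intro equals0I)
    fix e assume e: "e \<in> ?L \<inter> ?R"
    then have "e \<subseteq> set (xs @ [u]) \<inter> set (v # zs)"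
      using walk_edges_subset by blast
    then have "e \<subseteq> {u}" using dist by auto
    then show False using small e by blast
  qed
  have sumP: "(\<Sum>e\<in>P. x $ e) = (\<Sum>e\<in>?I. x $ e) + (\<Sum>e\<in>?L \<union> ?R. x $ e)" for x :: "real ^ 'v set"
  proof -
    have "P = ?I \<union> (?L \<union> ?R)" using P by auto
    moreover have "?I \<inter> (?L \<union> ?R) = {}" using LI RI by auto
    ultimately show ?thesis by (simp only: sum.union_disjoint finite_walk_edges finite_UnI)
  qed
  have valid1: "x $ {u, v} \<le> (\<Sum>e\<in>?I. x $ e)" if "x \<in> LMC V E F" for x
    using LMC_walk_inequality[of "u # ys @ [v]" x] that set_vs path P vs by auto
  have valid2: "x $ f \<le> x $ {u, v} + (\<Sum>e\<in>?L \<union> ?R. x $ e)" if "x \<in> LMC V E F" for x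
  proof -
    \<comment> \<open>The shortcut from \<open>hd vs\<close> to \<open>last vs\<close> over the
      chord.\<close>
    let ?ws = "(xs @ [u]) @ (v # zs)"
    have we: "walk_edges ?ws = insert {u, v} (?L \<union> ?R)"
      by (subst walk_edges_append) auto
    have "hd ?ws = hd vs" "last ?ws = last vs" using vs by (auto simp: hd_append)
    moreover have "walk_edges ?ws \<subseteq> K" using we uv path P by auto
    moreover have "set ?ws \<subseteq> V" using set_vs vs by auto
    ultimately have "x $ f \<le> (\<Sum>e\<in>insert {u, v} (?L \<union> ?R). x $ e)"
      using LMC_walk_inequality[of ?ws x] that we by auto
    also have "\<dots> = x $ {u, v} + (\<Sum>e\<in>?L \<union> ?R. x $ e)"
      using uvQ P by (subst sum.insert) auto
    finally show ?thesis .
  qed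
  let ?F1 = "{x \<in> LMC V E F. x $ {u, v} = (\<Sum>e\<in>?I. x $ e)}"
  have F1: "?F1 face_of LMC V E F"
    by (rule face_of_tight[OF convex_LMC valid1])
  \<comment> \<open>\<open>valid1\<close> and \<open>valid2\<close> add up to the path inequality,
    so equality in the sum forces equality in both.\<close>
  have sub: "tight \<subseteq> ?F1"
  proof
    fix x assume x: "x \<in> tight"
    then show "x \<in> ?F1"
      using valid1[of x] valid2[of x] sumP[of x] by auto
  qed
  have I: "?I = insert {u, hd ys} (walk_edges (ys @ [v]))"
    using ys by (subst walk_edges_Cons) auto
  have IK: "?I \<subseteq> K" using P path by auto
  have "card ?I = length (u # ys @ [v]) - 1"
    using dist by (intro card_walk_edges) auto
  moreover have "?I \<inter> K = ?I" using IK by auto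
  ultimately have "(\<Sum>e\<in>?I. char_vec K $ e) = real (Suc (length ys))"
    by (subst sum_char_vec) auto
  \<comment> \<open>As \<open>ys\<close> is nonempty, \<open>?I\<close> has at least two edges,
    whereas the chord contributes only 1.\<close>
  then have "char_vec K \<notin> ?F1"
    using ys uv by auto
  then have "?F1 \<noteq> LMC V E F"
    using char_vec_K_in_LMC by blast
  then have eq: "tight = ?F1"
    using facet_of_maximal[OF assms F1 sub _ convex_LMC] by blast
  \<comment> \<open>Witness against the equality of the faces: the only block that may have more
    than one node is \<open>?B\<close>. It cuts the chord and exactly one edge of \<open>?I\<close>,
    hence lies in \<open>?F1\<close>. It also cuts every edge of \<open>?L\<close> and
    \<open>?R\<close>, so at least two path edges are cut and it is not tight.\<close>
  let ?B = "set (ys @ [v])"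
  define M where "M = {e \<in> K. \<forall>U\<in>{?B}. \<not> e \<subseteq> U}"
  have M_iff: "e \<in> M \<longleftrightarrow> e \<in> K \<and> \<not> e \<subseteq> ?B" for e
    by (simp add: M_def)
  have "walk_edges (ys @ [v]) \<subseteq> E" using P path I by blast
  then have "conn_in E ?B" by (rule conn_in_walk)
  moreover have "?B \<subseteq> V" using set_vs vs by auto
  ultimately have M: "char_vec M \<in> LMC V E F"
    unfolding M_def by (intro char_vec_in_LMC) (auto simp: disjoint_def)
  have "{u, hd ys} \<in> M"
    using IK I dist M_iff by auto
  moreover have "e \<notin> M" if "e \<in> walk_edges (ys @ [v])" for e
    using walk_edges_subset[OF that] M_iff by blast
  ultimately have "?I \<inter> M = {{u, hd ys}}"
    unfolding I by blast
  then have I1: "(\<Sum>e\<in>?I. char_vec M $ e) = 1"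
    by (subst sum_char_vec) auto
  have "{u, v} \<in> M" using uv dist M_iff by auto
  then have "char_vec M $ {u, v} = 1" by simp
  then have "char_vec M \<in> ?F1"
    using M I1 by simp
  then have "char_vec M $ f = (\<Sum>e\<in>P. char_vec M $ e)"
    unfolding eq[symmetric] by blast
  moreover have "char_vec M $ f \<le> 1" by simp
  ultimately have le: "(\<Sum>e\<in>P. char_vec M $ e) \<le> 1" by linarith
  have "?L \<union> ?R \<noteq> {}"
    using xz by (cases "xs = []") (auto simp: walk_edges_append walk_edges_Cons)
  then obtain e where e: "e \<in> ?L \<union> ?R" by blast
  have "\<not> e \<subseteq> ?B"
  proof
    assume eB: "e \<subseteq> ?B"
    have "e \<subseteq> set (xs @ [u]) \<or> e \<subseteq> set (v # zs)"
      using e walk_edges_subset by blast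
    then have "e \<subseteq> {v}" using eB dist by auto
    then show False using small e by blast
  qed
  then have "e \<in> (?L \<union> ?R) \<inter> M" using e P path M_iff by blast
  then have "card ((?L \<union> ?R) \<inter> M) \<noteq> 0"
    by (auto simp: card_eq_0_iff)
  then have "real (card ((?L \<union> ?R) \<inter> M)) \<ge> 1" by linarith
  then have "(\<Sum>e\<in>?L \<union> ?R. char_vec M $ e) \<ge> 1"
    by (subst sum_char_vec) simp_all
  then show False
    using le I1 sumP[of "char_vec M"] by linarith
qed

end

section \<open>Chordless paths: tight vectors from splitting the path at most once\<close>

locale chordless_path = lifted_path V E F vs
  for V :: "'v::finite set" and E F :: "'v set set" and vs :: "'v list" +
  assumes chordless: "chordless (set vs) (insert {hd vs, last vs} (walk_edges vs)) (E \<union> F)"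
begin

abbreviation "I U \<equiv> induced_edges U K"

lemma I_iff: "e \<in> I U \<longleftrightarrow> e \<in> K \<and> e \<subseteq> U"
  by (simp add: induced_edges_def)

lemma Q_subset: "e \<in> Q \<Longrightarrow> e \<in> K \<and> e \<subseteq> set vs"
  using walk_edges_subset[of e vs] path ends by auto

text \<open>Chordlessness enters the argument in this form: the nodes of the path induce no edges of
  \<open>K\<close> beyond those of the cycle.\<close>

lemma I_path: "I (set vs) = Q"
proof
  show "I (set vs) \<subseteq> Q"
  proof
    fix e assume e: "e \<in> I (set vs)"
    then have "e \<in> K" by (simp only: I_iff)
    then obtain a b where "e = {a, b}" "a \<noteq> b" by (rule K_pair)
    then show "e \<in> Q" using e chordless by (auto simp: I_iff chordless_def)
  qed
  show "Q \<subseteq> I (set vs)"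
  proof
    fix e assume "e \<in> Q"
    then show "e \<in> I (set vs)" unfolding I_iff by (rule Q_subset)
  qed
qed

lemma I_subset_Q: "X \<subseteq> set vs \<Longrightarrow> I X \<subseteq> Q"
  unfolding I_path[symmetric] by (auto simp: induced_edges_def)

lemma Q_iff: "e \<in> Q \<longleftrightarrow> e \<in> K \<and> e \<subseteq> set vs"
  using I_path I_iff[of e "set vs"] by simp

lemma K_nonempty: "e \<in> K \<Longrightarrow> e \<noteq> {}"
  by (metis K_pair insert_not_empty)

text \<open>Both orientations are allowed because an outer piece \<open>R\<close> is always attached
  to the first part \<open>X\<close>, which may be the beginning or the end of the path. For
  \<open>k = 0\<close> or \<open>k\<close> at least the length, one part is empty.\<close>

definition path_split :: "'v set \<Rightarrow> 'v set \<Rightarrow> bool" where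
  "path_split X Y \<longleftrightarrow> (\<exists>k. (X = set (take k vs) \<and> Y = set (drop k vs)) \<or>
    (X = set (drop k vs) \<and> Y = set (take k vs)))"

lemma path_split_take: "path_split (set (take k vs)) (set (drop k vs))"
  and path_split_drop: "path_split (set (drop k vs)) (set (take k vs))"
  by (auto simp: path_split_def)

lemma path_split_disjoint:
  assumes "path_split X Y"
  shows "X \<union> Y = set vs" "X \<inter> Y = {}"
proof -
  have "set (take k vs) \<union> set (drop k vs) = set vs" for k
    by (metis append_take_drop_id set_append)
  moreover have "set (take k vs) \<inter> set (drop k vs) = {}" for k
    using distinct by (metis append_take_drop_id distinct_append)
  ultimately show "X \<union> Y = set vs" "X \<inter> Y = {}"
    using assms unfolding path_split_def by (metis sup_commute, metis inf_commute)
qed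

lemma walk_edges_take_drop:
  "walk_edges (take k vs) \<subseteq> P" "walk_edges (drop k vs) \<subseteq> P"
  using walk_edges_append[of "take k vs" "drop k vs"]
  by (cases "take k vs = [] \<or> drop k vs = []"; auto)+

lemma path_split_conn:
  assumes "path_split X Y"
  shows "conn_in E X" "conn_in E Y"
proof -
  have "conn_in E (set (take k vs))" "conn_in E (set (drop k vs))" for k
    using walk_edges_take_drop[of k] path by (auto intro!: conn_in_walk)
  then show "conn_in E X" "conn_in E Y"
    using assms unfolding path_split_def by auto
qed

text \<open>The ends of the path fall into different parts, so \<open>f\<close> is cut along with
  the path edge at the split; every other path edge stays within one part.\<close>

lemma split_cut:
  assumes "0 < k" "k < length vs"
  defines "e \<equiv> {last (take k vs), hd (drop k vs)}"
  shows "Q - I (set (take k vs)) - I (set (drop k vs)) = {e, f}" "e \<in> P"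
proof -
  let ?A = "take k vs" and ?B = "drop k vs"
  have ne: "?A \<noteq> []" "?B \<noteq> []" using assms by auto
  have P: "P = insert e (walk_edges ?A \<union> walk_edges ?B)"
    using walk_edges_append[OF ne] by (simp add: e_def)
  then show "e \<in> P" by simp
  have disj: "set ?A \<inter> set ?B = {}"
    using path_split_disjoint[OF path_split_take] by simp
  have e: "\<not> e \<subseteq> set ?A" "\<not> e \<subseteq> set ?B"
    using disj last_in_set[OF ne(1)] hd_in_set[OF ne(2)] unfolding e_def by blast+
  have "hd vs \<in> set ?A"
    using hd_in_set[OF ne(1)] assms(1) by (simp add: hd_take)
  moreover have "last vs \<in> set ?B"
    using ne(2) last_in_set[OF ne(2)] by (simp add: last_drop)
  ultimately have f: "\<not> f \<subseteq> set ?A" "\<not> f \<subseteq> set ?B"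
    using disj by auto
  have "walk_edges ?A \<subseteq> I (set ?A)" "walk_edges ?B \<subseteq> I (set ?B)"
    using walk_edges_subset[of _ ?A] walk_edges_subset[of _ ?B] walk_edges_take_drop[of k] path
    by (auto simp: I_iff)
  then show "Q - I (set ?A) - I (set ?B) = {e, f}"
    unfolding P using e f by (auto simp: I_iff)
qed

lemma path_split_cut:
  assumes "path_split X Y"
  shows "Q - I X - I Y = {} \<or> (\<exists>e\<in>P. Q - I X - I Y = {e, f})"
proof -
  have *: "Q - I (set (take k vs)) - I (set (drop k vs)) = {} \<or>
    (\<exists>e\<in>P. Q - I (set (take k vs)) - I (set (drop k vs)) = {e, f})" for k
  proof (cases "0 < k \<and> k < length vs")
    case True
    then show ?thesis using split_cut[of k] by blast
  next
    case False
    then have "k = 0 \<or> k \<ge> length vs" by auto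
    then show ?thesis using I_path by auto
  qed
  have "Q - I X - I Y = Q - I Y - I X" by auto
  then show ?thesis
    using assms * unfolding path_split_def by metis
qed

text \<open>Edges of \<open>Q\<close> avoid \<open>R\<close>, so on the cycle only the split
  matters. It cuts nothing, or \<open>f\<close> and one path edge; both sides of the inequality are
  then 0, or both are 1.\<close>

lemma block_vector_tight:
  assumes s: "path_split X Y" and R: "R \<subseteq> V" "R \<inter> set vs = {}" and c: "conn_in E (X \<union> R)"
  shows "char_vec (K - I (X \<union> R) - I Y) \<in> tight"
proof -
  let ?M = "K - I (X \<union> R) - I Y"
  note XY = path_split_disjoint[OF s]
  have "disjoint {X \<union> R, Y}" using XY R by (auto simp: disjoint_def)
  moreover have "U \<subseteq> V \<and> conn_in E U" if "U \<in> {X \<union> R, Y}" for U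
    using that XY R c path_split_conn[OF s] set_vs by auto
  ultimately have "char_vec {e \<in> K. \<forall>U\<in>{X \<union> R, Y}. \<not> e \<subseteq> U} \<in> LMC V E F"
    by (rule char_vec_in_LMC)
  moreover have "{e \<in> K. \<forall>U\<in>{X \<union> R, Y}. \<not> e \<subseteq> U} = ?M" by (auto simp: I_iff)
  ultimately have M: "char_vec ?M \<in> LMC V E F" by simp
  have "e \<in> ?M \<longleftrightarrow> e \<in> Q - I X - I Y" if "e \<in> Q" for e
  proof -
    have "e \<subseteq> X \<union> R \<longleftrightarrow> e \<subseteq> X" using Q_subset[OF that] XY R by blast
    then show ?thesis using Q_subset[OF that] that unfolding Diff_iff I_iff by blast
  qed
  then have QM: "Q \<inter> ?M = Q - I X - I Y" by blast
  consider "Q \<inter> ?M = {}" | e where "e \<in> P" "Q \<inter> ?M = {e, f}"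
    using path_split_cut[OF s] unfolding QM by blast
  then have "char_vec ?M $ f = real (card (P \<inter> ?M))"
  proof cases
    case 1
    then have "f \<notin> ?M" "P \<inter> ?M = {}" by blast+
    then show ?thesis by (simp only: char_vec_nth card.empty) simp
  next
    case 2
    then have "f \<in> ?M" "P \<inter> ?M = {e}" using f_notin_P by blast+
    then show ?thesis by (simp only: char_vec_nth) simp
  qed
  then show ?thesis using M by (simp only: mem_Collect_eq sum_char_vec finite_walk_edges)
qed

text \<open>The linear span has the dimension of the affine hull, because the origin is
  tight.\<close>

abbreviation "S \<equiv> span tight"

text \<open>Two tight vectors are compared: \<open>R\<close> dissolved into singletons, and
  \<open>R\<close> merged with \<open>X\<close>. Only \<open>X \<union> R\<close> has to be
  connected, not \<open>R\<close> itself; this matters when a walk runs through the path.\<close>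

lemma induced_in_span:
  assumes s: "path_split X Y" and R: "R \<subseteq> V" "R \<inter> set vs = {}" and c: "conn_in E (X \<union> R)"
  shows "char_vec (I (X \<union> R) - Q) \<in> S"
proof -
  note XY = path_split_disjoint[OF s]
  have "char_vec (K - I (X \<union> {}) - I Y) - char_vec (K - I (X \<union> R) - I Y) \<in> S"
    using block_vector_tight[OF s R c] block_vector_tight[OF s, of "{}"] path_split_conn[OF s]
    by (intro span_diff span_base) auto
  moreover have "char_vec (K - I (X \<union> {}) - I Y) - char_vec (K - I (X \<union> R) - I Y) =
    char_vec (I (X \<union> R) - Q)"
  proof -
    have "I X \<subseteq> Q" "I Y \<subseteq> Q" using XY(1) by (intro I_subset_Q; blast)+
    moreover have "e \<in> I X" if "e \<in> I (X \<union> R)" "e \<in> Q" for e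
      using that Q_subset[OF that(2)] R unfolding I_iff by blast
    moreover have "I X \<subseteq> I (X \<union> R)" "I (X \<union> R) \<subseteq> K" by (auto simp: induced_edges_def)
    ultimately have "K - I X - I Y - (K - I (X \<union> R) - I Y) = I (X \<union> R) - Q"
      "K - I (X \<union> R) - I Y \<subseteq> K - I X - I Y"
      by blast+
    then show ?thesis by (metis char_vec_Diff sup_bot.right_neutral)
  qed
  ultimately show ?thesis by simp
qed

section \<open>Unit vectors of the edges outside the cycle\<close>

definition cross :: "'v set \<Rightarrow> 'v \<Rightarrow> 'v set set" where
  "cross R v = {e \<in> K. \<exists>r\<in>R. e = {r, v}}"

text \<open>By chordlessness an edge of \<open>K\<close> outside \<open>Q\<close> has an end off the
  path. Inside \<open>X \<union> R\<close> it therefore lies within \<open>R\<close> or joins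
  \<open>R\<close> to exactly one node of \<open>X\<close>, so the union is disjoint.\<close>

lemma induced_split:
  assumes "X \<subseteq> set vs" "R \<inter> set vs = {}"
  shows "char_vec (I (X \<union> R) - Q) = char_vec (I R) + (\<Sum>v\<in>X. char_vec (cross R v))"
  using finite_subset[OF assms(1) finite_set] assms(1)
proof (induction X rule: finite_induct)
  case empty
  have "e \<notin> Q" if "e \<in> I R" for e
    using assms(2) Q_subset[of e] K_nonempty[of e] that I_iff[of e R] by blast
  then have "I R - Q = I R" by blast
  then show ?case by simp
next
  case (insert v X)
  have "I (insert v X \<union> R) - Q = (I (X \<union> R) - Q) \<union> cross R v" (is "?l = ?r")
  proof
    show "?l \<subseteq> ?r"
    proof
      fix e assume e: "e \<in> ?l"
      then have "e \<in> K" by (simp add: I_iff)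
      then obtain a b where ab: "e = {a, b}" "a \<noteq> b" by (rule K_pair)
      have "\<not> e \<subseteq> set vs" using e Q_iff[of e] \<open>e \<in> K\<close> by blast
      moreover have sub: "a \<in> insert v X \<union> R" "b \<in> insert v X \<union> R"
        using e ab(1) by (auto simp: induced_edges_def)
      ultimately have "a \<in> R \<or> b \<in> R" using ab(1) insert.prems by blast
      then have "e \<subseteq> X \<union> R \<or> (\<exists>r\<in>R. e = {r, v})"
        using sub ab by (auto simp: insert_commute)
      then show "e \<in> ?r" using e \<open>e \<in> K\<close> I_iff[of e "X \<union> R"] unfolding cross_def by blast
    qed
    show "?r \<subseteq> ?l"
    proof
      fix e assume "e \<in> ?r"
      then consider "e \<in> I (X \<union> R)" "e \<notin> Q" | r where "r \<in> R" "e = {r, v}" "e \<in> K"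
        unfolding cross_def by blast
      then show "e \<in> ?l"
      proof cases
        case 2
        then have "\<not> e \<subseteq> set vs" using assms(2) by auto
        then show ?thesis using 2 Q_subset[of e] I_iff[of e "insert v X \<union> R"] by blast
      qed (auto simp: induced_edges_def)
    qed
  qed
  moreover have "(I (X \<union> R) - Q) \<inter> cross R v = {}"
    using insert.hyps insert.prems assms(2) by (auto simp: I_iff cross_def)
  ultimately show ?case
    using insert by (simp add: char_vec_Un)
qed

text \<open>
  An initial segment of the path containing the neighbour \<open>w\<close> of \<open>R\<close> can be merged with \<open>R\<close>;
  otherwise its complement in the path can. Either way the sum of the cross vectors over the
  initial segment lies in the span, and consecutive segments differ in a single node.
\<close>

lemma cross_in_span:
  assumes R: "R \<subseteq> V" "R \<inter> set vs = {}" "conn_in E R" and r: "r \<in> R" "w \<in> set vs" "{r, w} \<in> E"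
    and v: "v \<in> set vs"
  shows "char_vec (cross R v) \<in> S"
proof -
  let ?s = "\<lambda>X. \<Sum>v\<in>X. char_vec (cross R v)"
  \<comment> \<open>With \<open>X\<close> empty, \<open>R\<close> is a block of its own; its vector
    is subtracted below to isolate the cross edges.\<close>
  have "char_vec (I ({} \<union> R) - Q) \<in> S"
    using induced_in_span[OF path_split_take[of 0] R(1,2)] R(3) by simp
  then have IR: "char_vec (I R) \<in> S"
    using induced_split[of "{}" R] R(2) by simp
  have s: "?s X \<in> S" if "path_split X Y" "w \<in> X" for X Y
  proof -
    have "conn_in E (X \<union> R)"
      using conn_in_Un_edge[OF path_split_conn(1)[OF that(1)] R(3) that(2) r(1)] r(3)
      by (simp add: insert_commute)
    then have "char_vec (I (X \<union> R) - Q) \<in> S"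
      by (rule induced_in_span[OF that(1) R(1,2)])
    moreover have "X \<subseteq> set vs" using path_split_disjoint[OF that(1)] by auto
    ultimately have "char_vec (I R) + ?s X \<in> S"
      using induced_split R(2) by simp
    then show ?thesis using span_diff[OF _ IR] by fastforce
  qed
  have all: "?s (set vs) \<in> S"
    using s[OF path_split_take[of "length vs"]] r(2) by simp
  have take: "?s (set (take k vs)) \<in> S" for k
  proof (cases "w \<in> set (take k vs)")
    case True
    then show ?thesis using s path_split_take by blast
  next
    case False
    note XY = path_split_disjoint[OF path_split_take[of k]]
    have "w \<in> set (drop k vs)" using False XY r(2) by auto
    then have "?s (set (drop k vs)) \<in> S" using s path_split_drop by blast
    then have "?s (set vs) - ?s (set (drop k vs)) \<in> S" using all by (rule span_diff[rotated])
    moreover have "?s (set vs) = ?s (set (take k vs)) + ?s (set (drop k vs))"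
      unfolding XY(1)[symmetric] by (rule sum.union_disjoint) (use XY in auto)
    ultimately show ?thesis by simp
  qed
  obtain j where j: "j < length vs" "v = vs ! j" using v by (metis in_set_conv_nth)
  have "set (take (Suc j) vs) = insert v (set (take j vs))"
    using j by (simp add: take_Suc_conv_app_nth)
  moreover have "v \<notin> set (take j vs)"
    using j distinct by (auto simp: in_set_conv_nth nth_eq_iff_index_eq)
  ultimately have eq: "?s (set (take (Suc j) vs)) - ?s (set (take j vs)) = char_vec (cross R v)"
    by simp
  show ?thesis using span_diff[OF take[of "Suc j"] take[of j]] unfolding eq .
qed

text \<open>Follow a walk from \<open>a\<close> until just before it first meets the path. This
  segment \<open>p\<close> and its tail \<open>rest\<close> without \<open>a\<close>, if nonempty,
  are connected and attach to the path at the same node, so \<open>cross_in_span\<close> applies to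
  both; their cross sets differ in \<open>{a, v}\<close> alone.\<close>

lemma cross_edge_in_span:
  assumes "a \<in> V" "a \<notin> set vs" "v \<in> set vs" "{a, v} \<in> K"
  shows "char_vec {{a, v}} \<in> S"
proof -
  have "hd vs \<in> V" using set_vs by auto
  then obtain ws where ws: "ws \<noteq> []" "distinct ws" "hd ws = a" "last ws = hd vs" "set ws \<subseteq> V"
    "walk_edges ws \<subseteq> E"
    using connected_graph_walk[OF connected assms(1)] by metis
  define p q where "p = takeWhile (\<lambda>x. x \<notin> set vs) ws" and "q = dropWhile (\<lambda>x. x \<notin> set vs) ws"
  have pq: "ws = p @ q" by (simp add: p_def q_def)
  have "last ws \<in> set ws" "last ws \<in> set vs" using ws(4) last_in_set[OF ws(1)] by auto
  then have q: "q \<noteq> []" "hd q \<in> set vs"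
    using hd_dropWhile[of "\<lambda>x. x \<notin> set vs" ws] by (auto simp: q_def dropWhile_eq_Nil_conv)
  obtain rest where rest: "p = a # rest"
    using ws(1,3) assms(2) by (cases ws) (auto simp: p_def)
  have p: "set p \<inter> set vs = {}" by (auto simp: p_def dest: set_takeWhileD)
  have "walk_edges ws = insert {last p, hd q} (walk_edges p \<union> walk_edges q)"
    unfolding pq by (rule walk_edges_append) (use rest q in auto)
  then have pE: "walk_edges p \<subseteq> E" "{last p, hd q} \<in> E" using ws(6) by auto
  have pV: "set p \<subseteq> V" using ws(5) pq by auto
  have 1: "char_vec (cross (set p) v) \<in> S"
    using p pE pV q(2) rest assms(3)
    by (intro cross_in_span[of _ "last p" "hd q"] conn_in_walk) auto
  have 2: "char_vec (cross (set rest) v) \<in> S"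
  proof (cases "rest = []")
    case True
    then show ?thesis by (simp add: cross_def span_zero)
  next
    case False
    then show ?thesis
      using p pE pV q(2) assms(3) unfolding rest
      by (intro cross_in_span[of _ "last rest" "hd q"] conn_in_walk)
        (auto simp: walk_edges_Cons)
  qed
  have "a \<notin> set rest" using ws(2) pq rest by auto
  then have eq: "cross (set p) v - cross (set rest) v = {{a, v}}"
    and sub: "cross (set rest) v \<subseteq> cross (set p) v"
    using assms unfolding rest by (auto simp: cross_def doubleton_eq_iff)
  show ?thesis using span_diff[OF 1 2] unfolding char_vec_Diff[OF sub, symmetric] eq .
qed

text \<open>Let \<open>R\<close> be the off-path nodes of the walk. The vector of all edges inside
  \<open>R\<close> is in the span, and each such edge other than the one joining the ends of the
  walk is handled by induction, since a strictly shorter subwalk connects its ends.\<close>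

lemma outer_edge_in_span:
  assumes "ws \<noteq> []" "walk_edges ws \<subseteq> E" "set ws \<subseteq> V" "{hd ws, last ws} \<in> K"
    "hd ws \<notin> set vs" "last ws \<notin> set vs"
  shows "char_vec {{hd ws, last ws}} \<in> S"
  using assms
proof (induction ws rule: measure_induct_rule[of length])
  case (less ws)
  let ?R = "set ws - set vs" and ?g = "{hd ws, last ws}"
  have R: "?R \<subseteq> V" "?R \<inter> set vs = {}" using less.prems by auto
  have conn: "conn_in E (set ws)" using less.prems by (intro conn_in_walk)
  have IR: "char_vec (I ?R) \<in> S"
  proof (cases "set ws \<inter> set vs = {}")
    case True
    then have "?R = set ws" by auto
    then have "char_vec (I ({} \<union> ?R) - Q) \<in> S"
      using induced_in_span[OF path_split_take[of 0] R] conn by simp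
    then show ?thesis using induced_split[of "{}" ?R] R(2) by simp
  next
    case False
    \<comment> \<open>A walk that meets the path is merged with the whole path, since
      \<open>R\<close> alone may be disconnected; the surplus edges between \<open>R\<close> and the
      path are already in the span.\<close>
    have s: "path_split (set vs) {}" using path_split_take[of "length vs"] by simp
    have "conn_in E (set vs \<union> set ws)"
      using False by (intro conn_in_Un path_split_conn(1)[OF s] conn) auto
    then have "char_vec (I (set vs \<union> ?R) - Q) \<in> S"
      by (intro induced_in_span[OF s R]) simp
    then have "char_vec (I ?R) + (\<Sum>v\<in>set vs. char_vec (cross ?R v)) \<in> S"
      using induced_split[OF order_refl R(2)] by simp
    moreover have "char_vec (cross ?R v) \<in> S" if "v \<in> set vs" for v
    proof (subst char_vec_sum, rule span_sum)
      fix e assume "e \<in> cross ?R v"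
      then show "char_vec {e} \<in> S"
        using that R by (auto simp: cross_def intro: cross_edge_in_span)
    qed
    then have "(\<Sum>v\<in>set vs. char_vec (cross ?R v)) \<in> S" by (intro span_sum)
    ultimately show ?thesis by (simp add: span_add_eq2)
  qed
  have g: "?g \<in> I ?R" using less.prems by (auto simp: I_iff)
  have "char_vec (I ?R - {?g}) \<in> S"
  proof (subst char_vec_sum, rule span_sum)
    fix e assume e: "e \<in> I ?R - {?g}"
    then have "e \<in> K" by (simp add: I_iff)
    then obtain a b where ab: "e = {a, b}" "a \<noteq> b" by (rule K_pair)
    then have "a \<in> set ws" "b \<in> set ws" using e by (auto simp: I_iff)
    then obtain xs u ys v zs where w: "ws = xs @ [u] @ ys @ [v] @ zs" and uv: "{u, v} = {a, b}"
      using split_list_pair ab(2) by metis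
    \<comment> \<open>The ends of \<open>e\<close> are not those of the walk, so the subwalk between
      them omits at least one entry.\<close>
    have xz: "xs \<noteq> [] \<or> zs \<noteq> []"
    proof (rule ccontr)
      assume "\<not> ?thesis"
      then have "?g = e" using w uv ab(1) by simp
      then show False using e by blast
    qed
    let ?ws = "u # ys @ [v]"
    have "walk_edges ?ws \<subseteq> walk_edges ws"
    proof -
      have "walk_edges ?ws \<subseteq> walk_edges (?ws @ zs)"
        using walk_edges_append[of ?ws zs] by (cases "zs = []") auto
      also have "\<dots> \<subseteq> walk_edges (xs @ (?ws @ zs))"
        using walk_edges_append[of xs "?ws @ zs"] by (cases "xs = []") auto
      finally show ?thesis using w by simp
    qed
    moreover have "length ?ws < length ws" using w xz by auto
    moreover have eq: "{hd ?ws, last ?ws} = e" using ab(1) uv by simp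
    moreover have "e \<subseteq> ?R" using e by (simp add: induced_edges_def)
    then have "hd ?ws \<notin> set vs" "last ?ws \<notin> set vs" unfolding eq[symmetric] by blast+
    moreover have "set ?ws \<subseteq> V" using less.prems(3) w by auto
    moreover have "?ws \<noteq> []" by simp
    moreover have "walk_edges ?ws \<subseteq> E" using less.prems(2) calculation(1) by (rule subset_trans[rotated])
    moreover have "{hd ?ws, last ?ws} \<in> K" using \<open>e \<in> K\<close> unfolding eq .
    ultimately have "char_vec {{hd ?ws, last ?ws}} \<in> S"
      by (intro less.IH)
    then show "char_vec {e} \<in> S" unfolding eq .
  qed
  then have "char_vec (I ?R) - char_vec (I ?R - {?g}) \<in> S" using IR by (intro span_diff)
  moreover have "char_vec (I ?R) - char_vec (I ?R - {?g}) = char_vec {?g}"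
    using g by (subst char_vec_Diff) auto
  ultimately show ?case by simp
qed

lemma edge_in_span:
  assumes "e \<in> K" "e \<notin> Q"
  shows "char_vec {e} \<in> S"
proof -
  obtain a b where ab: "e = {a, b}" "a \<noteq> b" "a \<in> V" "b \<in> V"
    using assms(1) by (rule K_pair)
  have "a \<notin> set vs \<or> b \<notin> set vs" using assms ab(1) Q_iff[of e] by blast
  then consider "a \<notin> set vs" "b \<in> set vs" | "a \<in> set vs" "b \<notin> set vs" | "a \<notin> set vs" "b \<notin> set vs"
    by blast
  then show ?thesis
  proof cases
    case 1
    then show ?thesis using cross_edge_in_span[of a b] ab assms by simp
  next
    case 2
    then show ?thesis using cross_edge_in_span[of b a] ab assms by (simp add: insert_commute)
  next
    case 3
    obtain ws where "ws \<noteq> []" "distinct ws" "hd ws = a" "last ws = b" "set ws \<subseteq> V"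
      "walk_edges ws \<subseteq> E"
      using connected_graph_walk[OF connected ab(3,4)] .
    then show ?thesis using outer_edge_in_span[of ws] 3 ab assms by auto
  qed
qed

text \<open>Splitting the path at \<open>e\<close> and keeping it whole, with all other nodes as
  singletons, yields two tight vectors that differ exactly in \<open>e\<close> and
  \<open>f\<close>.\<close>

lemma path_edge_in_span:
  assumes "e \<in> P"
  shows "char_vec {e, f} \<in> S"
proof -
  obtain i where i: "Suc i < length vs" "e = {vs ! i, vs ! Suc i}"
    using assms by (auto simp: walk_edges_def)
  let ?A = "set (take (Suc i) vs)" and ?B = "set (drop (Suc i) vs)"
  have e: "e = {last (take (Suc i) vs), hd (drop (Suc i) vs)}"
    using i by (simp add: take_Suc_conv_app_nth hd_drop_conv_nth)
  have cut: "Q - I ?A - I ?B = {e, f}"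
    using split_cut(1)[of "Suc i"] i(1) unfolding e by simp
  \<comment> \<open>The second vector is the split at 0: \<open>X\<close> is empty and
    \<open>Y\<close> is the whole path.\<close>
  have "char_vec (K - I (?A \<union> {}) - I ?B) \<in> S" "char_vec (K - I ({} \<union> {}) - I (set vs)) \<in> S"
    using block_vector_tight[OF path_split_take, of "{}" "Suc i"]
      block_vector_tight[OF path_split_take, of "{}" 0] path_split_conn(1)[OF path_split_take]
    by (auto intro!: span_base)
  moreover have "K - I ({} \<union> {}) - I (set vs) = K - Q"
    unfolding I_path using K_nonempty by (auto simp: induced_edges_def)
  ultimately have diff: "char_vec (K - I ?A - I ?B) - char_vec (K - Q) \<in> S"
    by (intro span_diff) simp_all
  have "I ?A \<subseteq> Q" "I ?B \<subseteq> Q"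
    using path_split_disjoint(1)[OF path_split_take[of "Suc i"]] by (intro I_subset_Q; blast)+
  moreover have "Q \<subseteq> K" using Q_subset by blast
  ultimately have "K - I ?A - I ?B - (K - Q) = {e, f}" and sub: "K - Q \<subseteq> K - I ?A - I ?B"
    unfolding cut[symmetric] by blast+
  then show ?thesis using diff unfolding char_vec_Diff[OF sub, symmetric] by simp
qed

text \<open>Adding the unit vector of \<open>f\<close> to the tight vectors yields all unit vectors
  of \<open>K\<close>, so the tight face has dimension at least \<open>card K - 1\<close>. Being
  proper, it lies strictly below the polytope, whose dimension is at most \<open>card K\<close>;
  this fixes the difference at one.\<close>

lemma tight_facet: "tight facet_of LMC V E F"
proof -
  let ?B = "(\<lambda>e. char_vec {e}) ` K :: (real ^ 'v set) set"
  let ?T = "insert (char_vec {f}) tight"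
  have mono: "S \<subseteq> span ?T" by (rule span_mono) auto
  have f: "char_vec {f} \<in> span ?T" by (rule span_base) simp
  have "char_vec {e} \<in> span ?T" if e: "e \<in> K" for e
  proof (cases "e \<in> Q")
    case False
    then show ?thesis using edge_in_span[OF e] mono by blast
  next
    case True
    then consider "e = f" | "e \<in> P" by blast
    then show ?thesis
    proof cases
      case 2
      then have "e \<noteq> f" using f_notin_P by blast
      then have "char_vec {e, f} - char_vec {f} = char_vec {e}"
        using char_vec_Un[of "{e}" "{f}"] by (simp add: insert_commute)
      moreover have "char_vec {e, f} - char_vec {f} \<in> span ?T"
        using path_edge_in_span[OF 2] mono f by (intro span_diff) blast+
      ultimately show ?thesis by simp
    qed (use f in simp)
  qed
  then have "?B \<subseteq> span ?T" by blast
  then have "card ?B \<le> dim ?T"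
    using independent_card_le_dim[of ?B "span ?T"] independent_char_vec(1)[of K] by simp
  then have "card K \<le> dim tight + 1"
    using independent_char_vec(2)[of K] dim_insert[of "char_vec {f}" tight]
    by (auto split: if_splits)
  moreover have z: "0 \<in> tight" using zero_in_LMC by simp
  then have "aff_dim tight = int (dim tight)"
    by (intro aff_dim_zero hull_inc)
  moreover have "aff_dim tight < aff_dim (LMC V E F)"
    by (rule face_of_aff_dim_lt[OF convex_LMC tight_face tight_proper])
  ultimately have "aff_dim tight = aff_dim (LMC V E F) - 1"
    using aff_dim_LMC_le by linarith
  then show ?thesis
    unfolding facet_of_def using tight_face z by blast
qed

end

section \<open>The equivalence for paths, transferred to both parts of the theorem\<close>

lemma (in lifted_path) defines_facet_iff_chordless:
  "defines_facet (\<lambda>x. x $ f) (\<lambda>x. \<Sum>e\<in>P. x $ e) (LMC V E F) \<longleftrightarrow> chordless (set vs) Q K"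
proof
  assume "defines_facet (\<lambda>x. x $ f) (\<lambda>x. \<Sum>e\<in>P. x $ e) (LMC V E F)"
  then show "chordless (set vs) Q K"
    unfolding defines_facet_def using facet_imp_chordless by blast
next
  assume "chordless (set vs) Q K"
  then interpret chordless_path V E F vs by unfold_locales
  show "defines_facet (\<lambda>x. x $ f) (\<lambda>x. \<Sum>e\<in>P. x $ e) (LMC V E F)"
    unfolding defines_facet_def using valid tight_facet by blast
qed

text \<open>Rotating the vertex list at \<open>f\<close> turns \<open>f\<close> into the closing
  edge, while the old closing edge joins \<open>ys\<close> to \<open>xs\<close> in the new
  list.\<close>

lemma is_cycle_edge_path:
  assumes "is_cycle VC EC" "f \<in> EC"
  obtains vs where "distinct vs" "3 \<le> length vs" "VC = set vs" "f = {hd vs, last vs}"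
    "EC = insert f (walk_edges vs)"
proof -
  obtain vs where vs: "3 \<le> length vs" "distinct vs" "VC = set vs"
    "EC = insert {last vs, hd vs} (walk_edges vs)"
    using assms(1) unfolding is_cycle_def by blast
  show thesis
  proof (cases "f = {last vs, hd vs}")
    case True
    then show thesis using that[of vs] vs by (simp add: insert_commute)
  next
    case False
    then have "f \<in> walk_edges vs" using assms(2) vs(4) by simp
    then obtain i where i: "Suc i < length vs" "f = {vs ! i, vs ! Suc i}"
      by (auto simp: walk_edges_def)
    define xs ys where "xs = take (Suc i) vs" and "ys = drop (Suc i) vs"
    have eq: "vs = xs @ ys" by (simp add: xs_def ys_def)
    have ne: "xs \<noteq> []" "ys \<noteq> []" using i(1) by (auto simp: xs_def ys_def)
    have f: "f = {last xs, hd ys}"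
      using i by (simp add: xs_def ys_def take_Suc_conv_app_nth hd_drop_conv_nth)
    have "EC = insert f (walk_edges (ys @ xs))"
      using vs(4) ne unfolding eq f
      by (simp add: walk_edges_append insert_commute Un_commute)
    moreover have "f = {hd (ys @ xs), last (ys @ xs)}"
      using f ne by (simp add: insert_commute)
    ultimately show thesis
      using that[of "ys @ xs"] vs(1-3) eq by (auto simp: Un_commute)
  qed
qed

theorem theorem5p8:
  fixes V :: "'v::finite set" and E F :: "'v set set"
  assumes "simple_graph V E"
    and "connected_graph V E"
    and "F \<subseteq> nsets V 2 - E"
  shows "(\<forall>VC EC f. is_cycle VC EC \<and> subgraph VC EC V E \<and> f \<in> EC \<longrightarrow>
            (defines_facet (\<lambda>x. x $ f) (\<lambda>x. \<Sum>e\<in>EC - {f}. x $ e) (LMC V E F)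
              \<longleftrightarrow> chordless VC EC (E \<union> F)))
       \<and> (\<forall>u v VP EP. {u, v} \<in> F \<and> is_path u v VP EP \<and> subgraph VP EP V E \<longrightarrow>
            (defines_facet (\<lambda>x. x $ {u, v}) (\<lambda>x. \<Sum>e\<in>EP. x $ e) (LMC V E F)
              \<longleftrightarrow> (let EC = insert {u, v} EP; VC = \<Union>EC
                   in is_cycle VC EC \<and> subgraph VC EC V (E \<union> F)
                      \<and> chordless VC EC (E \<union> F))))"
proof -
  have edges: "E \<union> F \<subseteq> nsets V 2"
    using assms(1,3) by (auto simp: simple_graph_def)
  show ?thesis
  proof (intro conjI allI impI; elim conjE)
    fix VC EC f
    assume C: "is_cycle VC EC" "subgraph VC EC V E" "f \<in> EC"
    obtain vs where vs: "distinct vs" "3 \<le> length vs" "VC = set vs" "f = {hd vs, last vs}"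
      "EC = insert f (walk_edges vs)"
      using is_cycle_edge_path[OF C(1,3)] .
    interpret lifted_path V E F vs
      by unfold_locales (use vs C edges assms(2) in \<open>auto simp: subgraph_def\<close>)
    have "EC - {f} = walk_edges vs"
      using ends_notin_walk_edges[OF vs(1,2)] vs(4,5) by blast
    then show "defines_facet (\<lambda>x. x $ f) (\<lambda>x. \<Sum>e\<in>EC - {f}. x $ e) (LMC V E F)
        \<longleftrightarrow> chordless VC EC (E \<union> F)"
      using defines_facet_iff_chordless vs(3-5) by simp
  next
    fix u v VP EP
    assume uv: "{u, v} \<in> F" and "is_path u v VP EP" and sub: "subgraph VP EP V E"
    then obtain vs where vs: "vs \<noteq> []" "distinct vs" "hd vs = u" "last vs = v" "VP = set vs"
      "EP = walk_edges vs"
      unfolding is_path_def by blast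
    have "{u, v} \<in> nsets V 2" using uv edges by blast
    then have "card {u, v} = 2" by (simp add: nsets_def)
    then have "u \<noteq> v" by auto
    have notin: "{u, v} \<notin> walk_edges vs"
      using uv sub vs(6) assms(3) by (auto simp: subgraph_def)
    \<comment> \<open>One node would give \<open>u = v\<close>; two nodes would make
      \<open>{u, v}\<close> a path edge, although \<open>F\<close> is disjoint from
      \<open>E\<close>.\<close>
    have len: "3 \<le> length vs"
    proof (rule ccontr)
      assume "\<not> ?thesis"
      moreover have "length vs \<noteq> 0" using vs(1) by simp
      ultimately have "length vs = 1 \<or> length vs = 2" by linarith
      then show False
        using notin vs \<open>u \<noteq> v\<close> by (auto simp: length_Suc_conv numeral_2_eq_2)
    qed
    interpret lifted_path V E F vs
      by unfold_locales (use vs uv sub edges assms(2) len in \<open>auto simp: subgraph_def\<close>)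
    have "\<Union>(walk_edges vs) = set vs"
      using len by (intro Union_walk_edges) simp
    then have VC: "\<Union>(insert {u, v} EP) = set vs"
      using vs by auto
    \<comment> \<open>The cycle and subgraph conditions hold by construction, so the equivalence
      comes down to chordlessness.\<close>
    have "is_cycle (set vs) (insert {u, v} EP)"
      unfolding is_cycle_def using len vs by (intro exI[of _ vs]) (simp add: insert_commute)
    moreover have "subgraph (set vs) (insert {u, v} EP) V (E \<union> F)"
      using sub uv vs(5) by (auto simp: subgraph_def)
    ultimately show "defines_facet (\<lambda>x. x $ {u, v}) (\<lambda>x. \<Sum>e\<in>EP. x $ e) (LMC V E F)
        \<longleftrightarrow> (let EC = insert {u, v} EP; VC = \<Union>EC
             in is_cycle VC EC \<and> subgraph VC EC V (E \<union> F) \<and> chordless VC EC (E \<union> F))"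
      using defines_facet_iff_chordless vs(3,4,6) unfolding Let_def VC by simp
  qed
qed

end
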